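(* Let $(X,d)$ be a nonempty metric space, let $\phi$ be a homeomorphism from $X$ onto itself, and suppose that there is a constant $C \ge 1$ such that $$C^{-1}\, d(x,y) \le d(\phi(x),\phi(y)) \le C\, d(x,y) \quad \text{for all } x,y \in X.$$ Let $Y_2$, $q_2$, $\rho$, $\delta$ and $\delta_0$ be as defined in the context. Then: (1) $\delta_0$ is nonnegative and symmetric on $Y_2 \times Y_2$, and satisfies the triangle inequality on $Y_2$. (2) For all $x,y \in X$ and $r,t \in \mathbf{R}$, $$\delta_0(q_2((x,r)),q_2((y,t))) \ge \operatorname{dist}(r-t,\mathbf{Z}).$$ (3) If $x,y\in X$ and $r,t \in \mathbf{R}$ satisfy $|r-t| \le \frac12$ and $\left|\frac{r+t}{2}\right| \le \frac12$, then $$\min\big(C^{-1}\rho((x,r),(y,t)),\, 1/2\big) \le \delta_0(q_2((x,r)),q_2((y,t))) \le \rho((x,r),(y,t)).$$ (4) Suppose in addition that $k \ge 1/2$ is a real number such that $d(x,y) \le k$ for all $x,y\in X$. Then $\delta_0(q_2((x,r)),q_2((y,t))) \le \delta(q_2((x,r)),q_2((y,t))) \le k$ for all $x,y\in X$ and $r,t\in\mathbf{R}$, and $$\rho((x,r),(y,t)) \le \max(C,2k)\, \delta_0(q_2((x,r)),q_2((y,t)))$$ for all $x,y \in X$ and $r,t\in\mathbf{R}$ with $|r-t| \le \frac12$ and $\left|\frac{r+t}{2}\right| \le \frac12$.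
   Context: Let $\Phi : X\times\mathbf{R} \to X\times\mathbf{R}$ be the homeomorphism $\Phi((x,t)) = (\phi(x),t+1)$, and let $\sim_2$ be the equivalence relation on $X\times\mathbf{R}$ with $(x,t)\sim_2 (x',t')$ if and only if $\Phi^n((x,t)) = (x',t')$ for some $n \in\mathbf{Z}$. Let $Y_2 = (X\times \mathbf{R})/\sim_2$, with quotient mapping $q_2 : X\times\mathbf{R}\to Y_2$. Put $\rho((x,r),(y,t)) = \max(d(x,y),|r-t|)$ for $x,y\in X$, $r,t\in\mathbf{R}$, which is a metric on $X \times \mathbf{R}$. For $a\in\mathbf{R}$, put $\operatorname{dist}(a,\mathbf{Z}) = \min_{n\in\mathbf{Z}}|a-n|$. For $x,y\in X$ and $r,t\in\mathbf{R}$, define $\delta(q_2((x,r)),q_2((y,t)))$ to be the minimum of $\rho((x',r'),(y',t'))$ over all $x',y'\in X$ and $r',t'\in\mathbf{R}$ such that $q_2((x',r')) = q_2((x,r))$, $q_2((y',t')) = q_2((y,t))$, $|r'-t'|\le 1/2$, and $|r'|,|t'|\le 3/4$. (This set of competitors is nonempty and finite.) For two elements $p,p'$ of $Y_2$, define $$\delta_0(p,p') = \inf \sum_{j=1}^n \delta(p_j,p_{j+1}),$$ where the infimum is taken over all positive integers $n$ and all finite sequences $p_1,\ldots,p_{n+1}$ of elements of $Y_2$ with $p_1 = p$ and $p_{n+1} = p'$. *)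

theory Defs
  imports "HOL-Analysis.Analysis"
begin

definition int_iter :: "('b \<Rightarrow> 'b) \<Rightarrow> int \<Rightarrow> 'b \<Rightarrow> 'b" where
  "int_iter f n = (if n \<ge> 0 then f ^^ nat n else (inv f) ^^ nat (- n))"

definition Phi :: "('a \<Rightarrow> 'a) \<Rightarrow> 'a \<times> real \<Rightarrow> 'a \<times> real" where
  "Phi \<phi> = (\<lambda>(x, t). (\<phi> x, t + 1))"

definition sim2 :: "('a \<Rightarrow> 'a) \<Rightarrow> (('a \<times> real) \<times> ('a \<times> real)) set" where
  "sim2 \<phi> = {(u, v). \<exists>n::int. int_iter (Phi \<phi>) n u = v}"

definition Y2 :: "('a \<Rightarrow> 'a) \<Rightarrow> ('a \<times> real) set set" where
  "Y2 \<phi> = UNIV // sim2 \<phi>"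

definition q2 :: "('a \<Rightarrow> 'a) \<Rightarrow> 'a \<times> real \<Rightarrow> ('a \<times> real) set" where
  "q2 \<phi> u = sim2 \<phi> `` {u}"

text \<open>The maximum metric, which differs from the (Euclidean) product metric that the library
  puts on the product type.\<close>

definition rho :: "'a::metric_space \<times> real \<Rightarrow> 'a \<times> real \<Rightarrow> real" where
  "rho u v = max (dist (fst u) (fst v)) \<bar>snd u - snd v\<bar>"

text \<open>The infimum is a minimum; see \<open>dist_Z_attained\<close> below.\<close>

definition dist_Z :: "real \<Rightarrow> real" where
  "dist_Z a = (INF n::int. \<bar>a - of_int n\<bar>)"

definition competitors ::
    "('a::metric_space \<Rightarrow> 'a) \<Rightarrow> ('a \<times> real) set \<Rightarrow> ('a \<times> real) set
      \<Rightarrow> (('a \<times> real) \<times> ('a \<times> real)) set" where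
  "competitors \<phi> p p' =
     {(u, v). q2 \<phi> u = p \<and> q2 \<phi> v = p' \<and> \<bar>snd u - snd v\<bar> \<le> 1/2 \<and>
        \<bar>snd u\<bar> \<le> 3/4 \<and> \<bar>snd v\<bar> \<le> 3/4}"

text \<open>For \<open>p\<close>, \<open>p'\<close> in \<open>Y2 \<phi>\<close> and bijective \<open>\<phi>\<close>, \<open>Min\<close> is applied to a finite nonempty set; see
  \<open>finite_competitors\<close> and \<open>competitors_nonempty\<close> below.\<close>

definition delta ::
    "('a::metric_space \<Rightarrow> 'a) \<Rightarrow> ('a \<times> real) set \<Rightarrow> ('a \<times> real) set \<Rightarrow> real" where
  "delta \<phi> p p' = Min ((\<lambda>(u, v). rho u v) ` competitors \<phi> p p')"

definition delta0 ::
    "('a::metric_space \<Rightarrow> 'a) \<Rightarrow> ('a \<times> real) set \<Rightarrow> ('a \<times> real) set \<Rightarrow> real" where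
  "delta0 \<phi> p p' =
     Inf {\<Sum>j=1..n. delta \<phi> (P j) (P (j + 1)) | (n::nat) (P :: nat \<Rightarrow> ('a \<times> real) set).
            n \<ge> 1 \<and> (\<forall>j\<in>{1..n+1}. P j \<in> Y2 \<phi>) \<and> P 1 = p \<and> P (n + 1) = p'}"

lemma dist_Z_attained: "\<exists>n::int. dist_Z a = \<bar>a - of_int n\<bar>"
proof
  have "\<bar>a - of_int (round a)\<bar> \<le> \<bar>a - of_int n\<bar>" for n :: int
    using round_diff_minimal[of a n] by simp
  then show "dist_Z a = \<bar>a - of_int (round a)\<bar>"
    unfolding dist_Z_def
    by (intro cInf_eq_minimum) auto
qed

lemma int_iter_0: "int_iter f 0 u = u"
  by (simp add: int_iter_def)

lemma int_iter_add1:
  assumes "bij f" shows "int_iter f (n + 1) u = f (int_iter f n u)"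
proof (cases "n \<ge> 0")
  case True
  then show ?thesis by (simp add: int_iter_def nat_add_distrib)
next
  case False
  then obtain k where k: "n = - int (Suc k)" by (metis int_cases not_le of_nat_0_le_iff)
  have "f (inv f w) = w" for w using assms by (simp add: bij_is_surj surj_f_inv_f)
  then show ?thesis using k by (cases k) (auto simp: int_iter_def nat_add_distrib)
qed

lemma int_iter_diff1:
  assumes "bij f" shows "int_iter f (n - 1) u = inv f (int_iter f n u)"
  using int_iter_add1[OF assms, of "n - 1" u] assms by (simp add: bij_is_inj)

lemma int_iter_add:
  assumes "bij f" shows "int_iter f (m + n) u = int_iter f m (int_iter f n u)"
proof (induction m rule: int_induct[where k = 0])
  case base
  show ?case by (simp add: int_iter_0)
next
  case (step1 i)
  then show ?case
    using int_iter_add1[OF assms] by (metis add.commute add.left_commute)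
next
  case (step2 i)
  have "i - 1 + n = (i + n) - 1" by simp
  with step2 show ?case using int_iter_diff1[OF assms] by metis
qed

lemma bij_Phi:
  assumes "bij \<phi>" shows "bij (Phi \<phi>)"
proof (rule bij_betw_byWitness[where f' = "\<lambda>(x, t). (inv \<phi> x, t - 1)"])
qed (use assms in \<open>auto simp: Phi_def bij_is_inj bij_is_surj surj_f_inv_f\<close>)

lemma snd_Phi: "snd (Phi \<phi> u) = snd u + 1"
  by (simp add: Phi_def split: prod.split)

lemma snd_int_iter_Phi:
  assumes "bij \<phi>" shows "snd (int_iter (Phi \<phi>) n u) = snd u + of_int n"
proof (induction n rule: int_induct[where k = 0])
  case base
  show ?case by (simp add: int_iter_0)
next
  case (step1 i)
  then show ?case
    by (simp add: int_iter_add1[OF bij_Phi[OF assms]] snd_Phi)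
next
  case (step2 i)
  then show ?case
    using int_iter_add1[OF bij_Phi[OF assms], of "i - 1" u]
    by (simp add: snd_Phi)
qed

lemma equiv_sim2:
  assumes "bij \<phi>" shows "equiv UNIV (sim2 \<phi>)"
proof (rule equivI)
  note add = int_iter_add[OF bij_Phi[OF assms]]
  show "refl (sim2 \<phi>)"
    by (auto simp: refl_on_def sim2_def intro: exI[of _ 0] int_iter_0)
  have "int_iter (Phi \<phi>) (- n) (int_iter (Phi \<phi>) n u) = u" for n u
    using add[of "- n" n u] by (simp add: int_iter_0)
  then show "sym (sim2 \<phi>)"
    unfolding sym_def sim2_def by blast
  show "trans (sim2 \<phi>)"
    unfolding trans_def sim2_def using add by (simp del: split_paired_All) metis
qed auto

lemma q2_in_Y2: "q2 \<phi> u \<in> Y2 \<phi>"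
  by (simp add: q2_def Y2_def quotientI)

lemma Y2_cases:
  assumes "p \<in> Y2 \<phi>" obtains u where "p = q2 \<phi> u"
  using assms by (auto simp: q2_def Y2_def quotient_def)

lemma q2_eq_iff:
  assumes "bij \<phi>" shows "q2 \<phi> u = q2 \<phi> v \<longleftrightarrow> (\<exists>n::int. int_iter (Phi \<phi>) n u = v)"
  using equiv_class_eq_iff[OF equiv_sim2[OF assms], of u v] by (simp add: q2_def sim2_def)

lemma finite_competitors:
  assumes "bij \<phi>" "p \<in> Y2 \<phi>" "p' \<in> Y2 \<phi>"
  shows "finite (competitors \<phi> p p')"
proof -
  have fin: "finite {u. q2 \<phi> u = q \<and> \<bar>snd u\<bar> \<le> 3/4}" if q: "q \<in> Y2 \<phi>" for q
  proof -
    obtain z where z: "q = q2 \<phi> z" using q by (rule Y2_cases)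
    have "u \<in> (\<lambda>n. int_iter (Phi \<phi>) n z) ` {\<lfloor>- 1 - snd z\<rfloor>..\<lceil>1 - snd z\<rceil>}"
      if u: "q2 \<phi> u = q" "\<bar>snd u\<bar> \<le> 3/4" for u
    proof -
      have "q2 \<phi> z = q2 \<phi> u" using u z by simp
      then obtain n where n: "int_iter (Phi \<phi>) n z = u" unfolding q2_eq_iff[OF assms(1)] by blast
      then have "snd u = snd z + of_int n" using snd_int_iter_Phi[OF assms(1), of n z] by simp
      then have "- 1 - snd z \<le> of_int n" "of_int n \<le> 1 - snd z" using u(2) by linarith+
      then have "n \<in> {\<lfloor>- 1 - snd z\<rfloor>..\<lceil>1 - snd z\<rceil>}" unfolding atLeastAtMost_iff by linarith
      then show ?thesis using n by blast
    qed
    then show ?thesis by (intro finite_subset[OF _ finite_imageI[OF finite_atLeastAtMost_int]]) blast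
  qed
  show ?thesis
    by (rule finite_subset[OF _ finite_cartesian_product[OF fin[OF assms(2)] fin[OF assms(3)]]])
      (auto simp: competitors_def)
qed

lemma competitors_nonempty:
  assumes "bij \<phi>" "p \<in> Y2 \<phi>" "p' \<in> Y2 \<phi>"
  shows "competitors \<phi> p p' \<noteq> {}"
proof -
  obtain z w where z: "p = q2 \<phi> z" and w: "p' = q2 \<phi> w" using assms(2,3) by (meson Y2_cases)
  define k where "k = round (snd z - snd w)"
  define m where "m = - round ((snd z + snd w + of_int k) / 2)"
  let ?u = "int_iter (Phi \<phi>) m z" and ?v = "int_iter (Phi \<phi>) (m + k) w"
  have "\<bar>of_int k - (snd z - snd w)\<bar> \<le> 1/2"
    unfolding k_def by (rule of_int_round_abs_le)
  moreover have "\<bar>of_int (- m) - (snd z + snd w + of_int k) / 2\<bar> \<le> 1/2"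
    unfolding m_def minus_minus by (rule of_int_round_abs_le)
  ultimately have "\<bar>snd ?u - snd ?v\<bar> \<le> 1/2" "\<bar>snd ?u\<bar> \<le> 3/4" "\<bar>snd ?v\<bar> \<le> 3/4"
    unfolding snd_int_iter_Phi[OF assms(1)] of_int_add of_int_minus by argo+
  moreover have "q2 \<phi> z = q2 \<phi> ?u" "q2 \<phi> w = q2 \<phi> ?v"
    unfolding q2_eq_iff[OF assms(1)] by blast+
  ultimately have "(?u, ?v) \<in> competitors \<phi> p p'"
    using z w by (simp add: competitors_def)
  then show ?thesis by blast
qed

end

theory Submission
  imports Defs
begin

text \<open>
  Everything rests on lifting chains from \<open>Y\<^sub>2\<close> to \<open>X \<times> \<real>\<close>. A minimizing
  competitor for \<open>\<delta>(p, p')\<close> is a pair of representatives; moving both by the same power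
  \<open>\<Phi>\<^sup>n\<close> lets the pair start at any prescribed representative of \<open>p\<close>, and leaves the
  difference of the real coordinates unchanged. Hence a chain of total \<open>\<delta>\<close>-length \<open>s\<close> from the
  class of \<open>u\<close> lifts to a path starting at \<open>u\<close> whose real coordinate has variation at most \<open>s\<close>
  (\<open>chain_lift\<close>). Since representatives of one point of \<open>Y\<^sub>2\<close> have real coordinates that differ
  by integers, this gives the lower bound by the distance to the integers.

  For the lower bound by \<open>\<rho> / C\<close>, only chains of length \<open>s < 1/2\<close> matter. Let the chain join
  the classes of \<open>(x, r)\<close> and \<open>(y, t)\<close>, where \<open>\<bar>r - t\<bar> \<le> 1/2\<close>. The lifted path ends at some
  real coordinate congruent to \<open>t\<close> and at distance less than \<open>1/2\<close> from \<open>r\<close>, hence less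
  than \<open>1\<close> from \<open>t\<close>; so it ends at \<open>(y, t)\<close> itself. Every real coordinate \<open>w\<close> on the path
  satisfies \<open>\<bar>w - r\<bar> + \<bar>w - t\<bar> < 1/2\<close>, so it lies within \<open>1/4\<close> of the midpoint \<open>(r + t) / 2\<close>, and
  thus in \<open>[-3/4, 3/4]\<close>. Competitors lie in the same strip, and two points of the strip that are
  related by \<open>\<Phi>\<^sup>n\<close> have \<open>\<bar>n\<bar> \<le> 1\<close>. So each step of the lift costs at most one
  application of \<open>\<phi>\<close> or of its inverse, that is, a single factor \<open>C\<close> that does not grow with the
  number of steps.

  The upper bounds hold because \<open>((x, r), (y, t))\<close> is itself a competitor under the conditions on
  \<open>r\<close> and \<open>t\<close>. If \<open>X\<close> has diameter at most \<open>k\<close>, then \<open>\<rho> \<le> k\<close> there, so the case where the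
  minimum in the lower bound is \<open>1/2\<close> is absorbed by the factor \<open>2 * k\<close>.
\<close>

section \<open>Minimizing competitors\<close>

lemma delta_attained:
  assumes "bij \<phi>" "p \<in> Y2 \<phi>" "p' \<in> Y2 \<phi>"
  obtains u v where "(u, v) \<in> competitors \<phi> p p'" "delta \<phi> p p' = rho u v"
proof -
  have "delta \<phi> p p' \<in> (\<lambda>(u, v). rho u v) ` competitors \<phi> p p'"
    unfolding delta_def
    by (intro Min_in finite_imageI finite_competitors) (use assms competitors_nonempty in auto)
  then show thesis using that by auto
qed

lemma delta_le_rho:
  assumes "bij \<phi>" "(u, v) \<in> competitors \<phi> p p'"
  shows "delta \<phi> p p' \<le> rho u v"
proof -
  have "p \<in> Y2 \<phi>" "p' \<in> Y2 \<phi>"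
    using assms(2) by (auto simp: competitors_def q2_in_Y2)
  then have "finite (competitors \<phi> p p')"
    using assms(1) by (rule finite_competitors[rotated])
  moreover have "rho u v \<in> (\<lambda>(u, v). rho u v) ` competitors \<phi> p p'"
    using assms(2) by force
  ultimately show ?thesis unfolding delta_def by simp
qed

lemma rho_nonneg: "rho u v \<ge> 0"
  by (simp add: rho_def le_max_iff_disj)

lemma rho_commute: "rho u v = rho v u"
  by (simp add: rho_def dist_commute abs_minus_commute)

lemma delta_nonneg:
  assumes "bij \<phi>" "p \<in> Y2 \<phi>" "p' \<in> Y2 \<phi>"
  shows "delta \<phi> p p' \<ge> 0"
  using delta_attained[OF assms] rho_nonneg by metis

lemma delta_commute: "delta \<phi> p p' = delta \<phi> p' p"
proof -
  have "(\<lambda>(u, v). rho u v) ` competitors \<phi> a b \<subseteq> (\<lambda>(u, v). rho u v) ` competitors \<phi> b a" for a b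
  proof clarify
    fix u v w z assume "((u, v), (w, z)) \<in> competitors \<phi> a b"
    then have "((w, z), (u, v)) \<in> competitors \<phi> b a"
      by (auto simp: competitors_def abs_minus_commute)
    then show "rho (u, v) (w, z) \<in> (\<lambda>(u, v). rho u v) ` competitors \<phi> b a"
      using rho_commute by force
  qed
  then show ?thesis unfolding delta_def by (metis subset_antisym)
qed

section \<open>Lengths of chains\<close>

text \<open>An inductive description of the sums over which \<open>delta0\<close> takes the infimum; it turns
  concatenation, reversal and lifting of chains into rule inductions.\<close>

inductive chain ::
    "('a::metric_space \<Rightarrow> 'a) \<Rightarrow> ('a \<times> real) set \<Rightarrow> ('a \<times> real) set \<Rightarrow> real \<Rightarrow> bool"
  for \<phi> where
  single: "p \<in> Y2 \<phi> \<Longrightarrow> p' \<in> Y2 \<phi> \<Longrightarrow> chain \<phi> p p' (delta \<phi> p p')"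
| step: "p \<in> Y2 \<phi> \<Longrightarrow> chain \<phi> p' p'' s \<Longrightarrow> chain \<phi> p p'' (delta \<phi> p p' + s)"

lemma chain_in_Y2:
  assumes "chain \<phi> p p' s" shows "p \<in> Y2 \<phi>" "p' \<in> Y2 \<phi>"
  using assms by (induction) auto

lemma sum_Suc_shift: "(\<Sum>j=1..Suc n. f j) = f 1 + (\<Sum>j=1..n. f (j + 1) :: real)"
  by (induction n) (simp_all add: add.assoc)

lemma chain_sum:
  fixes n :: nat
  assumes "n \<ge> 1" "\<forall>j\<in>{1..n+1}. P j \<in> Y2 \<phi>"
  shows "chain \<phi> (P 1) (P (n + 1)) (\<Sum>j=1..n. delta \<phi> (P j) (P (j + 1)))"
  using assms
proof (induction n arbitrary: P rule: nat_induct_at_least)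
  case base
  then show ?case using single[of "P 1" \<phi> "P 2"] by (simp add: numeral_2_eq_2)
next
  case (Suc n)
  have "chain \<phi> (P (1 + 1)) (P (n + 1 + 1)) (\<Sum>j=1..n. delta \<phi> (P (j + 1)) (P (j + 1 + 1)))"
    using Suc.IH[of "\<lambda>j. P (j + 1)"] Suc.prems by auto
  then have "chain \<phi> (P 1) (P (Suc n + 1))
      (delta \<phi> (P 1) (P (1 + 1)) + (\<Sum>j=1..n. delta \<phi> (P (j + 1)) (P (j + 1 + 1))))"
    using Suc.prems by (intro step) auto
  moreover have "(\<Sum>j=1..Suc n. delta \<phi> (P j) (P (j + 1)))
      = delta \<phi> (P 1) (P (1 + 1)) + (\<Sum>j=1..n. delta \<phi> (P (j + 1)) (P (j + 1 + 1)))"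
    by (rule sum_Suc_shift)
  ultimately show ?case by simp
qed

lemma sum_chain:
  assumes "chain \<phi> p p' s"
  shows "\<exists>(n::nat) P. n \<ge> 1 \<and> (\<forall>j\<in>{1..n+1}. P j \<in> Y2 \<phi>) \<and> P 1 = p \<and> P (n + 1) = p' \<and>
    s = (\<Sum>j=1..n. delta \<phi> (P j) (P (j + 1)))"
  using assms
proof induction
  case (single p p')
  then show ?case
    by (intro exI[of _ "1::nat"] exI[of _ "\<lambda>j::nat. if j = 1 then p else p'"]) auto
next
  case (step p p' p'' s)
  then obtain n :: nat and P where P: "n \<ge> 1" "\<forall>j\<in>{1..n+1}. P j \<in> Y2 \<phi>" "P 1 = p'" "P (n + 1) = p''"
    "s = (\<Sum>j=1..n. delta \<phi> (P j) (P (j + 1)))" by blast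
  define Q where "Q = (\<lambda>j. if j = 1 then p else P (j - 1))"
  have "(\<Sum>j=1..Suc n. delta \<phi> (Q j) (Q (j + 1)))
      = delta \<phi> (Q 1) (Q (1 + 1)) + (\<Sum>j=1..n. delta \<phi> (Q (j + 1)) (Q (j + 1 + 1)))"
    by (rule sum_Suc_shift)
  also have "(\<Sum>j=1..n. delta \<phi> (Q (j + 1)) (Q (j + 1 + 1))) = s"
    unfolding P(5) by (intro sum.cong) (auto simp: Q_def)
  also have "delta \<phi> (Q 1) (Q (1 + 1)) = delta \<phi> p p'"
    using P(3) by (simp add: Q_def)
  finally have "delta \<phi> p p' + s = (\<Sum>j=1..Suc n. delta \<phi> (Q j) (Q (j + 1)))" by simp
  moreover have "\<forall>j\<in>{1..Suc n+1}. Q j \<in> Y2 \<phi>"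
  proof
    fix j assume "j \<in> {1..Suc n + 1}"
    then have "j = 1 \<or> j - 1 \<in> {1..n + 1}" by auto
    then show "Q j \<in> Y2 \<phi>" using P(2) step.hyps(1) unfolding Q_def by presburger
  qed
  moreover have "Q 1 = p" "Q (Suc n + 1) = p''"
    using P(1,4) by (auto simp: Q_def)
  ultimately show ?case by (metis le_add1 plus_1_eq_Suc)
qed

lemma delta0_eq_Inf_chain: "delta0 \<phi> p p' = Inf {s. chain \<phi> p p' s}"
proof -
  have "{\<Sum>j=1..n. delta \<phi> (P j) (P (j + 1)) | (n::nat) (P :: nat \<Rightarrow> ('a \<times> real) set).
            n \<ge> 1 \<and> (\<forall>j\<in>{1..n+1}. P j \<in> Y2 \<phi>) \<and> P 1 = p \<and> P (n + 1) = p'} = {s. chain \<phi> p p' s}"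
    (is "?A = _")
  proof (intro set_eqI iffI)
    fix s assume "s \<in> ?A"
    then show "s \<in> {s. chain \<phi> p p' s}" using chain_sum[of _ _ \<phi>] by blast
  next
    fix s assume "s \<in> {s. chain \<phi> p p' s}"
    then show "s \<in> ?A" using sum_chain[of \<phi> p p' s] by blast
  qed
  then show ?thesis by (simp only: delta0_def)
qed

lemma chain_append:
  assumes "chain \<phi> p p' s" "chain \<phi> p' p'' s'"
  shows "chain \<phi> p p'' (s + s')"
  using assms by induction (auto simp: add.assoc intro: chain.intros)

lemma chain_reverse:
  assumes "chain \<phi> p p' s" shows "chain \<phi> p' p s"
  using assms
proof induction
  case (single p p')
  then show ?case using chain.single[of p' \<phi> p] by (simp add: delta_commute)
next
  case (step p p' p'' s)
  then have "chain \<phi> p' p (delta \<phi> p p')"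
    using chain.single[of p' \<phi> p] chain_in_Y2[of \<phi> p' p'' s] by (simp add: delta_commute)
  then show ?case using chain_append[OF step.IH] by (metis add.commute)
qed

lemma chain_nonneg:
  assumes "bij \<phi>" "chain \<phi> p p' s" shows "s \<ge> 0"
  using assms(2)
  by induction (auto simp: delta_nonneg[OF assms(1)] chain_in_Y2 intro!: add_nonneg_nonneg)

lemma delta0_le_chain:
  assumes "bij \<phi>" "chain \<phi> p p' s" shows "delta0 \<phi> p p' \<le> s"
  unfolding delta0_eq_Inf_chain
  by (rule cInf_lower) (use assms chain_nonneg in \<open>auto intro!: bdd_belowI[of _ 0]\<close>)

lemma le_delta0:
  assumes "p \<in> Y2 \<phi>" "p' \<in> Y2 \<phi>" "\<And>s. chain \<phi> p p' s \<Longrightarrow> b \<le> s"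
  shows "b \<le> delta0 \<phi> p p'"
  unfolding delta0_eq_Inf_chain
  by (rule cInf_greatest) (use assms single[of p \<phi> p'] in auto)

lemma delta0_le_delta:
  assumes "bij \<phi>" "p \<in> Y2 \<phi>" "p' \<in> Y2 \<phi>"
  shows "delta0 \<phi> p p' \<le> delta \<phi> p p'"
  using assms by (intro delta0_le_chain single)

lemma delta0_commute: "delta0 \<phi> p p' = delta0 \<phi> p' p"
proof -
  have "chain \<phi> p p' = chain \<phi> p' p" using chain_reverse by blast
  then show ?thesis by (simp add: delta0_eq_Inf_chain)
qed

lemma delta0_triangle:
  assumes "bij \<phi>" "p \<in> Y2 \<phi>" "p' \<in> Y2 \<phi>" "p'' \<in> Y2 \<phi>"
  shows "delta0 \<phi> p p'' \<le> delta0 \<phi> p p' + delta0 \<phi> p' p''"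
proof -
  have "delta0 \<phi> p p'' - s \<le> delta0 \<phi> p' p''" if "chain \<phi> p p' s" for s
  proof (rule le_delta0[OF assms(3,4)])
    fix s' assume "chain \<phi> p' p'' s'"
    then show "delta0 \<phi> p p'' - s \<le> s'"
      using delta0_le_chain[OF assms(1) chain_append[OF that]] by fastforce
  qed
  then have "delta0 \<phi> p p'' - delta0 \<phi> p' p'' \<le> delta0 \<phi> p p'"
    by (intro le_delta0[OF assms(2,3)]) (simp add: algebra_simps)
  then show ?thesis by simp
qed

section \<open>Lifting chains\<close>

lemma q2_int_iter:
  assumes "bij \<phi>" shows "q2 \<phi> (int_iter (Phi \<phi>) n u) = q2 \<phi> u"
  using q2_eq_iff[OF assms, of u] by metis

lemma q2_eq_snd:
  assumes "bij \<phi>" "q2 \<phi> u = q2 \<phi> v"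
  shows "\<exists>n::int. snd v = snd u + of_int n"
  using assms q2_eq_iff[OF assms(1)] snd_int_iter_Phi[OF assms(1)] by metis

lemma q2_eq_snd_eq:
  assumes "bij \<phi>" "q2 \<phi> u = q2 \<phi> v" "\<bar>snd u - snd v\<bar> < 1"
  shows "u = v"
proof -
  obtain n where n: "int_iter (Phi \<phi>) n u = v" using assms q2_eq_iff by metis
  then have "snd v = snd u + of_int n" using snd_int_iter_Phi[OF assms(1)] by metis
  then have "n = 0" using assms(3) by linarith
  then show ?thesis using n by (simp add: int_iter_0)
qed

lemma dist_int_iter_Phi:
  fixes C :: real
  assumes "bij \<phi>" "C \<ge> 1"
    and bilip: "\<And>x y. inverse C * dist x y \<le> dist (\<phi> x) (\<phi> y) \<and> dist (\<phi> x) (\<phi> y) \<le> C * dist x y"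
    and n: "\<bar>n\<bar> \<le> 1"
  shows "dist (fst (int_iter (Phi \<phi>) n a)) (fst (int_iter (Phi \<phi>) n b)) \<le> C * dist (fst a) (fst b)"
proof -
  have fst_Phi: "fst (Phi \<phi> u) = \<phi> (fst u)" for u
    by (simp add: Phi_def split: prod.split)
  note add1 = int_iter_add1[OF bij_Phi[OF assms(1)]]
  consider "n = -1" | "n = 0" | "n = 1" using n by linarith
  then show ?thesis
  proof cases
    case 1
    have inv: "\<phi> (fst (int_iter (Phi \<phi>) n u)) = fst u" for u
      using add1[of "-1" u] 1 by (metis fst_Phi int_iter_0 add.left_inverse)
    have "inverse C * dist (fst (int_iter (Phi \<phi>) n a)) (fst (int_iter (Phi \<phi>) n b))
        \<le> dist (fst a) (fst b)"
      using bilip[of "fst (int_iter (Phi \<phi>) n a)" "fst (int_iter (Phi \<phi>) n b)"] by (simp add: inv)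
    then show ?thesis using \<open>C \<ge> 1\<close> by (simp add: field_simps)
  next
    case 2
    show ?thesis
      using mult_right_mono[OF \<open>C \<ge> 1\<close>, of "dist (fst a) (fst b)"] by (simp add: 2 int_iter_0)
  next
    case 3
    then show ?thesis using add1[of 0] bilip by (simp add: int_iter_0 fst_Phi)
  qed
qed

text \<open>The bound on the first coordinates needs \<open>\<bar>snd u\<bar> \<le> 3/4\<close>: then \<open>u\<close> and the competitor
  that it replaces are within \<open>3/2\<close> of each other in the real direction, so at most one
  application of \<open>\<Phi>\<close> or of its inverse separates them.\<close>

lemma delta_lift:
  fixes C :: real
  assumes "bij \<phi>" "C \<ge> 1"
    and bilip: "\<And>x y. inverse C * dist x y \<le> dist (\<phi> x) (\<phi> y) \<and> dist (\<phi> x) (\<phi> y) \<le> C * dist x y"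
    and "p' \<in> Y2 \<phi>"
  shows "\<exists>v. q2 \<phi> v = p' \<and> \<bar>snd u - snd v\<bar> \<le> delta \<phi> (q2 \<phi> u) p' \<and>
    (\<bar>snd u\<bar> \<le> 3/4 \<longrightarrow> dist (fst u) (fst v) \<le> C * delta \<phi> (q2 \<phi> u) p')"
proof -
  obtain a b where ab: "(a, b) \<in> competitors \<phi> (q2 \<phi> u) p'" and d: "delta \<phi> (q2 \<phi> u) p' = rho a b"
    using delta_attained[OF assms(1) q2_in_Y2 assms(4)] .
  have a: "q2 \<phi> a = q2 \<phi> u" "\<bar>snd a\<bar> \<le> 3/4" and b: "q2 \<phi> b = p'"
    using ab by (auto simp: competitors_def)
  obtain n where n: "int_iter (Phi \<phi>) n a = u" using a(1) q2_eq_iff[OF assms(1)] by blast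
  define v where "v = int_iter (Phi \<phi>) n b"
  have snd_u: "snd u = snd a + of_int n" and snd_v: "snd v = snd b + of_int n"
    using snd_int_iter_Phi[OF assms(1)] n v_def by metis+
  have "\<bar>snd u - snd v\<bar> \<le> rho a b" by (simp add: snd_u snd_v rho_def)
  moreover have "dist (fst u) (fst v) \<le> C * rho a b" if "\<bar>snd u\<bar> \<le> 3/4"
  proof -
    have "\<bar>n\<bar> \<le> 1" using that a(2) snd_u by linarith
    from dist_int_iter_Phi[OF assms(1,2) bilip this, of a b]
    have "dist (fst u) (fst v) \<le> C * dist (fst a) (fst b)" by (simp add: n v_def)
    also have "\<dots> \<le> C * rho a b" using \<open>C \<ge> 1\<close> by (intro mult_left_mono) (auto simp: rho_def)
    finally show ?thesis .
  qed
  moreover have "q2 \<phi> v = p'" using b by (simp add: v_def q2_int_iter[OF assms(1)])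
  ultimately show ?thesis unfolding d by blast
qed

text \<open>The hypothesis \<open>\<bar>snd u + snd v\<bar> + s \<le> 3/2\<close> keeps the lifted path in the strip
  \<open>[-3/4, 3/4]\<close>: a point \<open>w\<close> of it has \<open>\<bar>w - snd u\<bar> + \<bar>w - snd v\<bar> \<le> s\<close>, hence
  \<open>2 * \<bar>w\<bar> \<le> \<bar>snd u + snd v\<bar> + s\<close>. In this form it passes to the rest of a chain when the first
  step is removed, because the midpoint then moves by at most half of what \<open>s\<close> loses.\<close>

lemma chain_lift:
  fixes C :: real
  assumes "bij \<phi>" "C \<ge> 1"
    and bilip: "\<And>x y. inverse C * dist x y \<le> dist (\<phi> x) (\<phi> y) \<and> dist (\<phi> x) (\<phi> y) \<le> C * dist x y"
    and "chain \<phi> p p' s" "q2 \<phi> u = p"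
  shows "\<exists>v. q2 \<phi> v = p' \<and> \<bar>snd u - snd v\<bar> \<le> s \<and>
    (\<bar>snd u + snd v\<bar> + s \<le> 3/2 \<longrightarrow> dist (fst u) (fst v) \<le> C * s)"
  using assms(4,5)
proof (induction arbitrary: u)
  case (single p p')
  obtain v where v: "q2 \<phi> v = p'" "\<bar>snd u - snd v\<bar> \<le> delta \<phi> p p'"
      "\<bar>snd u\<bar> \<le> 3/4 \<longrightarrow> dist (fst u) (fst v) \<le> C * delta \<phi> p p'"
    using delta_lift[OF assms(1,2) bilip single.hyps(2), of u] single.prems by metis
  have "\<bar>snd u\<bar> \<le> 3/4" if "\<bar>snd u + snd v\<bar> + delta \<phi> p p' \<le> 3/2"
    using that v(2) by argo
  then show ?case using v by blast
next
  case (step p p' p'' s)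
  obtain w where w: "q2 \<phi> w = p'" "\<bar>snd u - snd w\<bar> \<le> delta \<phi> p p'"
      "\<bar>snd u\<bar> \<le> 3/4 \<longrightarrow> dist (fst u) (fst w) \<le> C * delta \<phi> p p'"
    using delta_lift[OF assms(1,2) bilip chain_in_Y2(1)[OF step.hyps(2)], of u] step.prems by metis
  obtain v where v: "q2 \<phi> v = p''" "\<bar>snd w - snd v\<bar> \<le> s"
      "\<bar>snd w + snd v\<bar> + s \<le> 3/2 \<longrightarrow> dist (fst w) (fst v) \<le> C * s"
    using step.IH[OF w(1)] by blast
  have "\<bar>snd u - snd v\<bar> \<le> delta \<phi> p p' + s" using w(2) v(2) by argo
  moreover have "dist (fst u) (fst v) \<le> C * (delta \<phi> p p' + s)"
    if "\<bar>snd u + snd v\<bar> + (delta \<phi> p p' + s) \<le> 3/2"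
  proof -
    have "\<bar>snd u\<bar> \<le> 3/4" "\<bar>snd w + snd v\<bar> + s \<le> 3/2" using that w(2) v(2) by argo+
    then have "dist (fst u) (fst w) + dist (fst w) (fst v) \<le> C * delta \<phi> p p' + C * s"
      using w(3) v(3) by linarith
    then show ?thesis
      using dist_triangle[of "fst u" "fst v" "fst w"] by (simp add: distrib_left)
  qed
  ultimately show ?case using v(1) by blast
qed

section \<open>Comparison with the distance to the integers and with \<open>\<rho>\<close>\<close>

lemma dist_Z_le_delta0:
  fixes C :: real
  assumes "bij \<phi>" "C \<ge> 1"
    and bilip: "\<And>x y. inverse C * dist x y \<le> dist (\<phi> x) (\<phi> y) \<and> dist (\<phi> x) (\<phi> y) \<le> C * dist x y"
  shows "dist_Z (snd u - snd v) \<le> delta0 \<phi> (q2 \<phi> u) (q2 \<phi> v)"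
proof (rule le_delta0[OF q2_in_Y2 q2_in_Y2])
  fix s assume "chain \<phi> (q2 \<phi> u) (q2 \<phi> v) s"
  from chain_lift[OF assms this refl]
  obtain w where w: "q2 \<phi> w = q2 \<phi> v" "\<bar>snd u - snd w\<bar> \<le> s" by blast
  obtain n :: int where n: "snd v = snd w + of_int n" using q2_eq_snd[OF assms(1) w(1)] by blast
  have "dist_Z (snd u - snd v) \<le> \<bar>(snd u - snd v) - of_int (- n)\<bar>"
    unfolding dist_Z_def by (rule cINF_lower) (auto intro!: bdd_belowI[of _ 0])
  then show "dist_Z (snd u - snd v) \<le> s" using w(2) n by simp
qed

lemma min_rho_le_delta0:
  fixes C :: real
  assumes "bij \<phi>" "C \<ge> 1"
    and bilip: "\<And>x y. inverse C * dist x y \<le> dist (\<phi> x) (\<phi> y) \<and> dist (\<phi> x) (\<phi> y) \<le> C * dist x y"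
    and uv: "\<bar>snd u - snd v\<bar> \<le> 1/2" "\<bar>(snd u + snd v) / 2\<bar> \<le> 1/2"
  shows "min (inverse C * rho u v) (1/2) \<le> delta0 \<phi> (q2 \<phi> u) (q2 \<phi> v)"
proof (rule le_delta0[OF q2_in_Y2 q2_in_Y2])
  fix s assume s: "chain \<phi> (q2 \<phi> u) (q2 \<phi> v) s"
  show "min (inverse C * rho u v) (1/2) \<le> s"
  proof (cases "s < 1/2")
    case True
    obtain w where w: "q2 \<phi> w = q2 \<phi> v" "\<bar>snd u - snd w\<bar> \<le> s"
        "\<bar>snd u + snd w\<bar> + s \<le> 3/2 \<longrightarrow> dist (fst u) (fst w) \<le> C * s"
      using chain_lift[OF assms(1-3) s refl] by blast
    have "\<bar>snd w - snd v\<bar> < 1" using w(2) uv(1) True by linarith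
    then have "w = v" by (rule q2_eq_snd_eq[OF assms(1) w(1)])
    moreover have "\<bar>snd u + snd v\<bar> + s \<le> 3/2" using uv(2) True by simp
    ultimately have "dist (fst u) (fst v) \<le> C * s" "\<bar>snd u - snd v\<bar> \<le> s" using w by blast+
    moreover have "s \<le> C * s"
      using mult_right_mono[OF \<open>C \<ge> 1\<close> chain_nonneg[OF assms(1) s]] by simp
    ultimately have "rho u v \<le> C * s" by (simp add: rho_def)
    then have "inverse C * rho u v \<le> s" using \<open>C \<ge> 1\<close> by (simp add: field_simps)
    then show ?thesis by simp
  qed simp
qed

theorem mainTheorem1:
  fixes \<phi> :: "'a::metric_space \<Rightarrow> 'a" and C :: real
  assumes homeo: "\<exists>\<psi>. homeomorphism UNIV UNIV \<phi> \<psi>"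
    and C: "C \<ge> 1"
    and bilip: "\<And>x y. inverse C * dist x y \<le> dist (\<phi> x) (\<phi> y)
                     \<and> dist (\<phi> x) (\<phi> y) \<le> C * dist x y"
  shows
    "((\<forall>p\<in>Y2 \<phi>. \<forall>p'\<in>Y2 \<phi>. delta0 \<phi> p p' \<ge> 0) \<and>
      (\<forall>p\<in>Y2 \<phi>. \<forall>p'\<in>Y2 \<phi>. delta0 \<phi> p p' = delta0 \<phi> p' p) \<and>
      (\<forall>p\<in>Y2 \<phi>. \<forall>p'\<in>Y2 \<phi>. \<forall>p''\<in>Y2 \<phi>.
         delta0 \<phi> p p'' \<le> delta0 \<phi> p p' + delta0 \<phi> p' p''))
     \<and>
     (\<forall>x y r t. delta0 \<phi> (q2 \<phi> (x, r)) (q2 \<phi> (y, t)) \<ge> dist_Z (r - t))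
     \<and>
     (\<forall>x y r t. \<bar>r - t\<bar> \<le> 1/2 \<and> \<bar>(r + t) / 2\<bar> \<le> 1/2 \<longrightarrow>
        min (inverse C * rho (x, r) (y, t)) (1/2) \<le> delta0 \<phi> (q2 \<phi> (x, r)) (q2 \<phi> (y, t)) \<and>
        delta0 \<phi> (q2 \<phi> (x, r)) (q2 \<phi> (y, t)) \<le> rho (x, r) (y, t))
     \<and>
     (\<forall>k::real. k \<ge> 1/2 \<and> (\<forall>x y::'a. dist x y \<le> k) \<longrightarrow>
        (\<forall>x y r t. delta0 \<phi> (q2 \<phi> (x, r)) (q2 \<phi> (y, t)) \<le> delta \<phi> (q2 \<phi> (x, r)) (q2 \<phi> (y, t)) \<and>
                   delta \<phi> (q2 \<phi> (x, r)) (q2 \<phi> (y, t)) \<le> k) \<and>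
        (\<forall>x y r t. \<bar>r - t\<bar> \<le> 1/2 \<and> \<bar>(r + t) / 2\<bar> \<le> 1/2 \<longrightarrow>
           rho (x, r) (y, t) \<le> max C (2 * k) * delta0 \<phi> (q2 \<phi> (x, r)) (q2 \<phi> (y, t))))"
proof -
  obtain \<psi> where "homeomorphism UNIV UNIV \<phi> \<psi>" using homeo by blast
  then have bij: "bij \<phi>"
    by (intro bij_betw_byWitness[where f' = \<psi>]) (auto simp: homeomorphism_def)
  have nonneg: "0 \<le> delta0 \<phi> p p'" if "p \<in> Y2 \<phi>" "p' \<in> Y2 \<phi>" for p p'
    using that chain_nonneg[OF bij] by (rule le_delta0)
  note dist_Z = dist_Z_le_delta0[OF bij C bilip]
  note lower = min_rho_le_delta0[OF bij C bilip]
  have upper: "delta0 \<phi> (q2 \<phi> (x, r)) (q2 \<phi> (y, t)) \<le> rho (x, r) (y, t)"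
    if "\<bar>r - t\<bar> \<le> 1/2" "\<bar>(r + t) / 2\<bar> \<le> 1/2" for x y r t
  proof -
    have "\<bar>r\<bar> \<le> 3/4" "\<bar>t\<bar> \<le> 3/4" using that by argo+
    then have "((x, r), (y, t)) \<in> competitors \<phi> (q2 \<phi> (x, r)) (q2 \<phi> (y, t))"
      using that by (simp add: competitors_def)
    then show ?thesis
      using delta_le_rho[OF bij] delta0_le_delta[OF bij q2_in_Y2 q2_in_Y2] order_trans by blast
  qed
  have delta_le_k: "delta \<phi> (q2 \<phi> u) (q2 \<phi> v) \<le> k"
    if "k \<ge> 1/2" "\<forall>x y::'a. dist x y \<le> k" for k u v
  proof -
    obtain a b where "(a, b) \<in> competitors \<phi> (q2 \<phi> u) (q2 \<phi> v)"
        "delta \<phi> (q2 \<phi> u) (q2 \<phi> v) = rho a b"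
      using delta_attained[OF bij q2_in_Y2 q2_in_Y2] .
    then show ?thesis using that by (auto simp: competitors_def rho_def)
  qed
  have rho_le: "rho (x, r) (y, t) \<le> max C (2 * k) * delta0 \<phi> (q2 \<phi> (x, r)) (q2 \<phi> (y, t))"
    if k: "k \<ge> 1/2" "\<forall>x y::'a. dist x y \<le> k" and rt: "\<bar>r - t\<bar> \<le> 1/2" "\<bar>(r + t) / 2\<bar> \<le> 1/2"
    for k x y r t
  proof -
    let ?D = "delta0 \<phi> (q2 \<phi> (x, r)) (q2 \<phi> (y, t))"
    have D: "?D \<ge> 0" by (intro nonneg q2_in_Y2)
    consider "inverse C * rho (x, r) (y, t) \<le> ?D" | "1/2 \<le> ?D"
      using lower[of "(x, r)" "(y, t)"] rt by force
    then show ?thesis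
    proof cases
      case 1
      then have "rho (x, r) (y, t) \<le> C * ?D" using C by (simp add: field_simps)
      also have "\<dots> \<le> max C (2 * k) * ?D" using D by (intro mult_right_mono) auto
      finally show ?thesis .
    next
      case 2
      have "rho (x, r) (y, t) \<le> k" using k rt by (simp add: rho_def)
      also have "k \<le> 2 * k * ?D" using mult_left_mono[OF 2, of "2 * k"] k(1) by simp
      also have "\<dots> \<le> max C (2 * k) * ?D" using D by (intro mult_right_mono) auto
      finally show ?thesis .
    qed
  qed
  show ?thesis
  proof (intro conjI ballI allI impI; (elim conjE)?)
    fix x y :: 'a and r t :: real
    show "dist_Z (r - t) \<le> delta0 \<phi> (q2 \<phi> (x, r)) (q2 \<phi> (y, t))"
      using dist_Z[of "(x, r)" "(y, t)"] by simp
  next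
    fix x y :: 'a and r t :: real
    assume "\<bar>r - t\<bar> \<le> 1/2" "\<bar>(r + t) / 2\<bar> \<le> 1/2"
    then show "min (inverse C * rho (x, r) (y, t)) (1/2) \<le> delta0 \<phi> (q2 \<phi> (x, r)) (q2 \<phi> (y, t))"
      using lower[of "(x, r)" "(y, t)"] by simp
  qed (rule nonneg delta0_commute delta0_triangle[OF bij] upper delta_le_k rho_le
      delta0_le_delta[OF bij q2_in_Y2 q2_in_Y2]; assumption)+
qed

end
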